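(* Let $\boldsymbol\delta^1,\dots,\boldsymbol\delta^M\in\{0,1\}^I$ be $M\ge1$ vectors of sensitivity parameters, $\gamma\ge0$, $T$ a count-based test statistic with observed value $T_{\rm obs}\in\mathbb{R}$. For each $m$ let $\overline p_{\gamma,\boldsymbol\delta^m}(T_{\rm obs})=\max_{\mathbf{u}\in[0,1]^N}p_{\gamma,\boldsymbol\delta^m}(T_{\rm obs},\mathbf{u})$ be the worst-case $p$-value under $\boldsymbol\delta^m$. Then $$\max_{\mathbf{u}\in[0,1]^N,\ \boldsymbol\delta\in\{\boldsymbol\delta^1,\dots,\boldsymbol\delta^M\}}p_{\gamma,\boldsymbol\delta}(T_{\rm obs},\mathbf{u})=\max\big(\overline p_{\gamma,\boldsymbol\delta^1}(T_{\rm obs}),\dots,\overline p_{\gamma,\boldsymbol\delta^M}(T_{\rm obs})\big).$$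
   Context: Fix integers $N$, $I\ge 2$, $J\ge 2$ and positive integers $N_{1\cdot},\dots,N_{I\cdot}$ with $\sum_i N_{i\cdot}=N$. Let $\mathcal{Z}(\mathbf{N}_{I\cdot})=\{\mathbf{z}\in\{1,\dots,I\}^N:\ |\{s:z_s=i\}|=N_{i\cdot}\ \forall i\}$. The outcome vector $\mathbf{r}\in\{1,\dots,J\}^N$ is fixed (sharp null hypothesis). For $\mathbf{z}\in\mathcal{Z}(\mathbf{N}_{I\cdot})$, $\mathbf{N}(\mathbf{z},\mathbf{r})$ is the $I\times J$ table with entries $N_{ij}=\sum_{s=1}^N\mathbb{1}\{z_s=i,r_s=j\}$; a count-based test statistic is a real-valued function $T$ of this table. For $\boldsymbol\delta\in\{0,1\}^I$ and $\mathbf{u}\in[0,1]^N$, the exact one-sided $p$-value $\mathbb{P}_{H_0}(T\ge T_{\rm obs})$ at $\mathbf{u}$ is $$p_{\gamma,\boldsymbol\delta}(T_{\rm obs},\mathbf{u})=\frac{\sum_{\mathbf{z}\in\mathcal{Z}(\mathbf{N}_{I\cdot})}\mathbb{1}\{T(\mathbf{N}(\mathbf{z},\mathbf{r}))\ge T_{\rm obs}\}\exp\{\gamma\sum_{s=1}^N\delta_{z_s}u_s\}}{\sum_{\mathbf{b}\in\mathcal{Z}(\mathbf{N}_{I\cdot})}\exp\{\gamma\sum_{s=1}^N\delta_{b_s}u_s\}}.$$ *)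

theory Defs
  imports Complex_Main "HOL-Library.FuncSet"
begin

text \<open>A vector of length \<open>n\<close> with entries in \<open>A\<close> is an element of \<open>{1..n} \<rightarrow>\<^sub>E A\<close>. Extensionality
  makes each vector a single function, so sums over assignment vectors count each of them once.\<close>

definition has_maximum :: "real set \<Rightarrow> bool" where
  "has_maximum S \<longleftrightarrow> (\<exists>x\<in>S. \<forall>y\<in>S. y \<le> x)"

text \<open>Maximum of a possibly infinite set (\<^const>\<open>Max\<close> is only meaningful for finite ones).
  It is unspecified unless \<open>has_maximum S\<close>.\<close>

definition maximum :: "real set \<Rightarrow> real" where
  "maximum S = (GREATEST x. x \<in> S)"

definition assignments :: "nat \<Rightarrow> nat \<Rightarrow> (nat \<Rightarrow> nat) \<Rightarrow> (nat \<Rightarrow> nat) set" where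
  "assignments N I n = {z \<in> {1..N} \<rightarrow>\<^sub>E {1..I}. \<forall>i\<in>{1..I}. card {s\<in>{1..N}. z s = i} = n i}"

text \<open>For \<open>z\<close> with entries in \<open>{1..I}\<close> and \<open>r\<close> with entries in \<open>{1..J}\<close>, all cells outside
  \<open>{1..I} \<times> {1..J}\<close> are \<open>0\<close>, so this function carries exactly the \<open>I \<times> J\<close> table.\<close>

definition table :: "nat \<Rightarrow> (nat \<Rightarrow> nat) \<Rightarrow> (nat \<Rightarrow> nat) \<Rightarrow> nat \<Rightarrow> nat \<Rightarrow> nat" where
  "table N z r = (\<lambda>i j. \<Sum>s=1..N. of_bool (z s = i \<and> r s = j))"

definition unit_cube :: "nat \<Rightarrow> (nat \<Rightarrow> real) set" where
  "unit_cube N = {1..N} \<rightarrow>\<^sub>E {0..1}"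

definition p_value ::
  "nat \<Rightarrow> nat \<Rightarrow> (nat \<Rightarrow> nat) \<Rightarrow> (nat \<Rightarrow> nat) \<Rightarrow> ((nat \<Rightarrow> nat \<Rightarrow> nat) \<Rightarrow> real)
    \<Rightarrow> real \<Rightarrow> (nat \<Rightarrow> real) \<Rightarrow> real \<Rightarrow> (nat \<Rightarrow> real) \<Rightarrow> real" where
  "p_value N I n r T \<gamma> \<delta> t u =
    (\<Sum>z\<in>assignments N I n. of_bool (T (table N z r) \<ge> t) * exp (\<gamma> * (\<Sum>s=1..N. \<delta> (z s) * u s)))
    / (\<Sum>b\<in>assignments N I n. exp (\<gamma> * (\<Sum>s=1..N. \<delta> (b s) * u s)))"

definition worst_case_p_value ::
  "nat \<Rightarrow> nat \<Rightarrow> (nat \<Rightarrow> nat) \<Rightarrow> (nat \<Rightarrow> nat) \<Rightarrow> ((nat \<Rightarrow> nat \<Rightarrow> nat) \<Rightarrow> real)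
    \<Rightarrow> real \<Rightarrow> (nat \<Rightarrow> real) \<Rightarrow> real \<Rightarrow> real" where
  "worst_case_p_value N I n r T \<gamma> \<delta> t =
    maximum {p_value N I n r T \<gamma> \<delta> t u | u. u \<in> unit_cube N}"

end

theory Submission
  imports Defs "HOL-Analysis.Function_Topology"
begin

lemma maximum_eqI:
  assumes "x \<in> S" and "\<And>y. y \<in> S \<Longrightarrow> y \<le> x"
  shows "maximum S = x"
  unfolding maximum_def using assms by (intro Greatest_equality) auto

text \<open>The largest of the finitely many maxima is attained in the set it comes from, and it
  dominates any \<open>y\<close> in the union through the maximum of a set containing
  \<open>y\<close>.\<close>

lemma has_maximum_UN:
  fixes S :: "'a \<Rightarrow> real set"
  assumes "finite A" and "A \<noteq> {}" and "\<And>a. a \<in> A \<Longrightarrow> has_maximum (S a)"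
  shows "has_maximum (\<Union>a\<in>A. S a) \<and> maximum (\<Union>a\<in>A. S a) = Max ((\<lambda>a. maximum (S a)) ` A)"
proof -
  let ?m = "Max ((\<lambda>a. maximum (S a)) ` A)"
  \<comment> \<open>A witness of \<open>has_maximum\<close> is forced to equal
    \<open>maximum (S a)\<close>, so the latter is a genuine greatest element and not an unspecified
    value.\<close>
  have max: "maximum (S a) \<in> S a \<and> (\<forall>y\<in>S a. y \<le> maximum (S a))" if "a \<in> A" for a
    using assms(3)[OF that] maximum_eqI unfolding has_maximum_def by metis
  have "?m \<in> (\<lambda>a. maximum (S a)) ` A"
    using assms by (intro Max_in) auto
  then have mem: "?m \<in> (\<Union>a\<in>A. S a)"
    using max by (metis (no_types, lifting) UN_I imageE)
  have ub: "y \<le> ?m" if y: "y \<in> (\<Union>a\<in>A. S a)" for y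
  proof -
    obtain a where a: "a \<in> A" "y \<in> S a"
      using y by auto
    then have "y \<le> maximum (S a)"
      using max by auto
    also have "\<dots> \<le> ?m"
      using a assms(1) by (intro Max_ge) auto
    finally show ?thesis .
  qed
  show ?thesis
    using mem ub maximum_eqI[OF mem ub] unfolding has_maximum_def by blast
qed

text \<open>The topology on \<^typ>\<open>nat \<Rightarrow> real\<close> is the product topology over all indices, so the
  extensional cube is the product with singleton factors \<open>{undefined}\<close> outside \<open>{1..N}\<close>.\<close>

lemma compact_unit_cube: "compact (unit_cube N)"
proof -
  let ?F = "\<lambda>i::nat. if i \<in> {1..N} then {0..1::real} else {undefined}"
  have eq: "unit_cube N = PiE UNIV ?F"
    unfolding unit_cube_def PiE_def Pi_def extensional_def by (auto split: if_splits)
  have "compactin (product_topology (\<lambda>i. euclidean) UNIV) (PiE UNIV ?F)"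
    \<comment> \<open>Tychonoff: every factor is a closed interval or a single point, hence
      compact.\<close>
    unfolding compactin_PiE by auto
  then show ?thesis
    unfolding eq euclidean_product_topology by (simp add: compactin_euclidean_iff)
qed

lemma unit_cube_nonempty: "unit_cube N \<noteq> {}"
  unfolding unit_cube_def PiE_eq_empty_iff by auto

lemma finite_assignments: "finite (assignments N I n)"
proof (rule finite_subset)
  show "assignments N I n \<subseteq> {1..N} \<rightarrow>\<^sub>E {1..I}"
    unfolding assignments_def by blast
qed (auto intro: finite_PiE)

text \<open>As a function of \<open>u\<close> this is a quotient of finite sums of exponentials of
  linear forms in the coordinates; only a vanishing denominator could break continuity.\<close>

lemma continuous_on_p_value: "continuous_on S (p_value N I n r T \<gamma> \<delta> t)"
proof (cases "assignments N I n = {}")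
  \<comment> \<open>Both sums are empty, and the convention \<open>0 / 0 = 0\<close> makes the
    function constant.\<close>
  case True
  then show ?thesis
    unfolding p_value_def by simp
next
  case False
  have coord: "continuous_on S (\<lambda>u. u s)" for s :: nat and S :: "(nat \<Rightarrow> real) set"
    by (rule continuous_on_product_then_coordinatewise) (rule continuous_on_id)
  have "(\<Sum>b\<in>assignments N I n. exp (\<gamma> * (\<Sum>s=1..N. \<delta> (b s) * u s))) > 0" for u
    using False finite_assignments by (intro sum_pos) auto
  then have "(\<Sum>b\<in>assignments N I n. exp (\<gamma> * (\<Sum>s=1..N. \<delta> (b s) * u s))) \<noteq> 0" for u
    by (metis less_irrefl)
  then show ?thesis
    unfolding p_value_def[abs_def] by (intro continuous_intros coord) auto
qed

text \<open>Extreme value theorem on the compact nonempty cube. It ensures that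
  \<open>worst_case_p_value\<close> is an attained value.\<close>

lemma has_maximum_p_value:
  "has_maximum {p_value N I n r T \<gamma> \<delta> t u | u. u \<in> unit_cube N}"
proof -
  obtain v where "v \<in> unit_cube N"
    and "\<forall>u\<in>unit_cube N. p_value N I n r T \<gamma> \<delta> t u \<le> p_value N I n r T \<gamma> \<delta> t v"
    using continuous_attains_sup[OF compact_unit_cube unit_cube_nonempty continuous_on_p_value]
    by meson
  then show ?thesis
    unfolding has_maximum_def by fast
qed

theorem corollary2:
  fixes N I J M :: nat
    and n r :: "nat \<Rightarrow> nat"
    and T :: "(nat \<Rightarrow> nat \<Rightarrow> nat) \<Rightarrow> real"
    and \<delta> :: "nat \<Rightarrow> nat \<Rightarrow> real"
    and \<gamma> t_obs :: real
  assumes "I \<ge> 2" and "J \<ge> 2" and "M \<ge> 1"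
    and "\<forall>i\<in>{1..I}. n i > 0"
    and "(\<Sum>i=1..I. n i) = N"
    and "r \<in> {1..N} \<rightarrow>\<^sub>E {1..J}"
    and "\<forall>m\<in>{1..M}. \<delta> m \<in> {1..I} \<rightarrow>\<^sub>E {0, 1}"
    and "\<gamma> \<ge> 0"
  shows "(\<forall>m\<in>{1..M}. has_maximum {p_value N I n r T \<gamma> (\<delta> m) t_obs u | u. u \<in> unit_cube N})
    \<and> has_maximum {p_value N I n r T \<gamma> d t_obs u | u d. u \<in> unit_cube N \<and> d \<in> \<delta> ` {1..M}}
    \<and> maximum {p_value N I n r T \<gamma> d t_obs u | u d. u \<in> unit_cube N \<and> d \<in> \<delta> ` {1..M}}
        = Max ((\<lambda>m. worst_case_p_value N I n r T \<gamma> (\<delta> m) t_obs) ` {1..M})"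
proof -
  let ?S = "\<lambda>m. {p_value N I n r T \<gamma> (\<delta> m) t_obs u | u. u \<in> unit_cube N}"
  \<comment> \<open>Slicing the joint search space by the index \<open>m\<close> turns the joint
    maximum into that of a finite union; indices with equal vectors merely repeat a slice.\<close>
  have eq: "{p_value N I n r T \<gamma> d t_obs u | u d. u \<in> unit_cube N \<and> d \<in> \<delta> ` {1..M}}
      = (\<Union>m\<in>{1..M}. ?S m)"
    by blast
  have "{1..M} \<noteq> {}"
    using \<open>M \<ge> 1\<close> by simp
  then show ?thesis
    unfolding eq worst_case_p_value_def
    using has_maximum_UN[of "{1..M}" ?S] has_maximum_p_value by blast
qed

end
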